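(* Let $n\ge 3$ be an integer and let $G$ be a finite solvable group such that the character degree graph $\Delta(G)$ has exactly $n$ vertices, has diameter $2$, is not a block, and has the structure $\Delta(G)=K_{n-(n_1+1)} - v - K_{n_1}$ with $n_1$ an integer satisfying $1\le n_1\le n-(n_1+1)$. Then the Laplacian spectrum of $\Delta(G)$ is $$\begin{pmatrix} 0 & 1 & n & n_1+1 & n-n_1\\ 1&1&1& n_1-1 & n-(n_1+2)\end{pmatrix}.$$
   Context: For a finite group $G$, $\mathrm{Irr}(G)$ is the set of complex irreducible characters of $G$, $\mathrm{cd}(G)=\{\chi(1) : \chi\in \mathrm{Irr}(G)\}$, and $\rho(G)$ is the set of primes dividing some element of $\mathrm{cd}(G)$. The character degree graph $\Delta(G)$ is the simple undirected graph with vertex set $\rho(G)$ in which distinct primes $p,q$ are adjacent if and only if $pq$ divides some $r\in \mathrm{cd}(G)$. A block of a graph is a maximal connected subgraph having no cut vertex of its own; a connected graph "is not a block" if it has a cut vertex. The notation $\Gamma=K_{a}-v-K_{b}$ means that the vertex set of $\Gamma$ is the disjoint union of a set $A$ of size $a$, a set $B$ of size $b$ and a single vertex $v$, where $A\cup\{v\}$ and $B\cup\{v\}$ each induce complete subgraphs and there are no edges between $A$ and $B$. The Laplacian matrix of a finite simple graph $\Gamma$ is $L(\Gamma)=D(\Gamma)-A(\Gamma)$, with $D(\Gamma)$ the diagonal matrix of vertex degrees and $A(\Gamma)$ the adjacency matrix; the Laplacian spectrum is the multiset of eigenvalues of $L(\Gamma)$, displayed as a two-row array with eigenvalues in the first row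 and their multiplicities in the second row (multiplicity $0$ means the column contributes nothing, and if two columns have the same eigenvalue their multiplicities are added). *)

theory Defs
  imports
    "HOL-Algebra.Solvable_Groups"
    "HOL-Computational_Algebra.Primes"
    "Jordan_Normal_Form.Char_Poly"
    "Jordan_Normal_Form.VS_Connect"
    "Graph_Theory.Graph_Theory"
begin

section \<open>Irreducible characters and character degrees\<close>

definition GL :: "nat \<Rightarrow> complex mat monoid" where
  "GL d = units_of (ring_mat TYPE(complex) d ())"

text \<open>Subspaces of the column space are taken in the sense of \<^locale>\<open>VectorSpace.subspace\<close>.
  The zero representation (\<open>d = 0\<close>) is not irreducible.\<close>

definition irreducible_rep ::
    "('a, 'b) monoid_scheme \<Rightarrow> nat \<Rightarrow> ('a \<Rightarrow> complex mat) \<Rightarrow> bool" where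
  "irreducible_rep G d R \<longleftrightarrow>
     R \<in> hom G (GL d) \<and> d > 0 \<and>
     (\<forall>W. VectorSpace.subspace class_ring W (module_vec TYPE(complex) d) \<and>
          (\<forall>g \<in> carrier G. \<forall>w \<in> W. R g *\<^sub>v w \<in> W)
        \<longrightarrow> W = {0\<^sub>v d} \<or> W = carrier_vec d)"

definition mat_trace :: "'a::comm_ring_1 mat \<Rightarrow> 'a" where
  "mat_trace A = sum_list (diag_mat A)"

text \<open>Characters are functions on the carrier, hence extensional: without the restriction,
  the junk values of a representation outside the carrier would distinguish characters.\<close>

definition Irr :: "('a, 'b) monoid_scheme \<Rightarrow> ('a \<Rightarrow> complex) set" where
  "Irr G = {\<lambda>g\<in>carrier G. mat_trace (R g) | d R. irreducible_rep G d R}"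

definition cd :: "('a, 'b) monoid_scheme \<Rightarrow> nat set" where
  "cd G = {m. \<exists>\<chi> \<in> Irr G. \<chi> \<one>\<^bsub>G\<^esub> = of_nat m}"

definition degree_primes :: "('a, 'b) monoid_scheme \<Rightarrow> nat set" where
  "degree_primes G = {p. prime p \<and> (\<exists>m \<in> cd G. p dvd m)}"

text \<open>Undirected graphs are symmetric digraphs without loops, as in \<^locale>\<open>graph\<close>:
  an edge between \<open>p\<close> and \<open>q\<close> is the pair of arcs \<open>(p, q)\<close> and \<open>(q, p)\<close>.\<close>

definition degree_graph :: "('a, 'b) monoid_scheme \<Rightarrow> (nat, nat \<times> nat) pre_digraph" where
  "degree_graph G = with_proj
     \<lparr> pverts = degree_primes G,
       parcs = {(p, q). p \<in> degree_primes G \<and> q \<in> degree_primes G \<and> p \<noteq> q \<and>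
                        (\<exists>r \<in> cd G. p * q dvd r)} \<rparr>"

section \<open>Diameter, cut vertices and blocks\<close>

text \<open>With all arcs of cost 1, \<^const>\<open>wf_digraph.\<mu>\<close> is the distance; it is \<open>\<infinity>\<close> between
  vertices in different components.\<close>

definition diameter :: "('a, 'b) pre_digraph \<Rightarrow> ereal" where
  "diameter \<Gamma> = (SUP u \<in> verts \<Gamma>. SUP v \<in> verts \<Gamma>. wf_digraph.\<mu> \<Gamma> (\<lambda>_. 1) u v)"

text \<open>In a symmetric digraph the strongly connected components are the connected components.\<close>

definition cut_vertex :: "('a, 'b) pre_digraph \<Rightarrow> 'a \<Rightarrow> bool" where
  "cut_vertex \<Gamma> v \<longleftrightarrow> v \<in> verts \<Gamma> \<and>
     card (pre_digraph.sccs (pre_digraph.del_vert \<Gamma> v)) > card (pre_digraph.sccs \<Gamma>)"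

text \<open>A graph is a block if it is a block of itself; the maximality in the definition of the
  blocks of a graph is then vacuous.\<close>

definition is_block :: "('a, 'b) pre_digraph \<Rightarrow> bool" where
  "is_block \<Gamma> \<longleftrightarrow> Digraph_Component.connected \<Gamma> \<and> (\<nexists>v. cut_vertex \<Gamma> v)"

text \<open>\<open>\<Gamma> = K\<^sub>a - v - K\<^sub>b\<close> for some vertex \<open>v\<close>.\<close>

definition two_cliques_at_vertex :: "nat \<Rightarrow> nat \<Rightarrow> ('a, 'b) pre_digraph \<Rightarrow> bool" where
  "two_cliques_at_vertex a b \<Gamma> \<longleftrightarrow>
     (\<exists>A B v. verts \<Gamma> = A \<union> B \<union> {v} \<and> A \<inter> B = {} \<and> v \<notin> A \<and> v \<notin> B \<and>
        card A = a \<and> card B = b \<and>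
        complete_digraph (a + 1) (induce_subgraph \<Gamma> (A \<union> {v})) \<and>
        complete_digraph (b + 1) (induce_subgraph \<Gamma> (B \<union> {v})) \<and>
        (\<forall>x \<in> A. \<forall>y \<in> B. (x, y) \<notin> arcs_ends \<Gamma> \<and> (y, x) \<notin> arcs_ends \<Gamma>))"

section \<open>Laplacian spectrum\<close>

text \<open>Rows and columns are indexed by the vertices in increasing order.\<close>

definition vertex_list :: "('a::linorder, 'b) pre_digraph \<Rightarrow> 'a list" where
  "vertex_list \<Gamma> = sorted_list_of_set (verts \<Gamma>)"

definition adjacency_mat :: "('a::linorder, 'b) pre_digraph \<Rightarrow> real mat" where
  "adjacency_mat \<Gamma> = mat (card (verts \<Gamma>)) (card (verts \<Gamma>))
     (\<lambda>(i, j). if (vertex_list \<Gamma> ! i, vertex_list \<Gamma> ! j) \<in> arcs_ends \<Gamma> then 1 else 0)"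

text \<open>In a graph, the out-degree of a vertex is its degree.\<close>

definition degree_mat :: "('a::linorder, 'b) pre_digraph \<Rightarrow> real mat" where
  "degree_mat \<Gamma> = mat (card (verts \<Gamma>)) (card (verts \<Gamma>))
     (\<lambda>(i, j). if i = j then real (out_degree \<Gamma> (vertex_list \<Gamma> ! i)) else 0)"

definition laplacian_mat :: "('a::linorder, 'b) pre_digraph \<Rightarrow> real mat" where
  "laplacian_mat \<Gamma> = degree_mat \<Gamma> - adjacency_mat \<Gamma>"

text \<open>Eigenvalues are taken over the complex numbers, so that none is lost, and counted with
  their multiplicity as roots of the characteristic polynomial.\<close>

definition laplacian_spectrum :: "('a::linorder, 'b) pre_digraph \<Rightarrow> complex multiset" where
  "laplacian_spectrum \<Gamma> = proots (char_poly (map_mat complex_of_real (laplacian_mat \<Gamma>)))"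

text \<open>A two-row array, given as the list of its columns (eigenvalue, multiplicity).\<close>

definition spectrum_array :: "('c \<times> nat) list \<Rightarrow> 'c multiset" where
  "spectrum_array cs = (\<Sum>(x, m) \<leftarrow> cs. replicate_mset m x)"

end

theory Submission
  imports Defs
begin

text \<open>
  Only the shape of the graph matters, not the group. Let \<open>a = |A|\<close> and \<open>b = |B|\<close>, and fix
  \<open>a0 \<in> A\<close>, \<open>b0 \<in> B\<close>. The Laplacian has the following basis of eigenvectors: the constant vector
  (eigenvalue 0); \<open>b\<close> on \<open>A\<close>, \<open>-a\<close> on \<open>B\<close>, \<open>0\<close> at \<open>v\<close> (eigenvalue 1); \<open>a + b\<close> at \<open>v\<close>, \<open>-1\<close>
  elsewhere (eigenvalue \<open>a + b + 1\<close>); the differences of the unit vectors at \<open>x\<close> and \<open>a0\<close> for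
  \<open>x \<in> A - {a0}\<close> (eigenvalue \<open>a + 1\<close>), and those at \<open>x\<close> and \<open>b0\<close> for \<open>x \<in> B - {b0}\<close>
  (eigenvalue \<open>b + 1\<close>).
\<close>

section \<open>Characteristic polynomial from a basis of eigenvectors\<close>

text \<open>With the eigenvectors as the columns of \<open>P\<close>, the eigenvalue equations
  become \<open>A * P = P * D\<close> with \<open>D\<close> diagonal, and independence makes
  \<open>P\<close> invertible, so \<open>A\<close> is similar to \<open>D\<close>. Rows, columns and
  eigenvectors are all indexed by the elements of \<open>xs\<close>, so that vertices can later take
  the place of matrix positions.\<close>

lemma char_poly_eigenbasis:
  fixes K F :: "'v \<Rightarrow> 'v \<Rightarrow> 'k::field" and ev :: "'v \<Rightarrow> 'k"
  assumes xs: "distinct xs"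
    and eigen: "\<And>x j. \<lbrakk>x \<in> set xs; j \<in> set xs\<rbrakk> \<Longrightarrow>
                  (\<Sum>y\<in>set xs. K x y * F j y) = ev j * F j x"
    and indep: "\<forall>c. (\<forall>x\<in>set xs. (\<Sum>i\<in>set xs. c i * F i x) = 0) \<longrightarrow> (\<forall>i\<in>set xs. c i = 0)"
  shows "char_poly (mat (length xs) (length xs) (\<lambda>(i, j). K (xs ! i) (xs ! j))) =
         (\<Prod>j\<in>set xs. [:- ev j, 1:])"
proof -
  define n where "n = length xs"
  define A where "A = mat n n (\<lambda>(i, j). K (xs ! i) (xs ! j))"
  define P where "P = mat n n (\<lambda>(i, j). F (xs ! j) (xs ! i))"
  define D where "D = mat n n (\<lambda>(i, j). if i = j then ev (xs ! i) else 0)"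
  have carr: "A \<in> carrier_mat n n" "P \<in> carrier_mat n n" "D \<in> carrier_mat n n"
    by (auto simp: A_def P_def D_def)
  have bij: "bij_betw ((!) xs) {0..<n} (set xs)"
    using xs by (simp add: bij_betw_nth n_def atLeast0LessThan)
  have sum_xs: "(\<Sum>i = 0..<n. f (xs ! i)) = (\<Sum>x\<in>set xs. f x)" for f :: "'v \<Rightarrow> 'k"
    by (rule sum.reindex_bij_betw[OF bij])
  have AP: "A * P = P * D"
  proof (rule eq_matI)
    fix i j assume "i < dim_row (P * D)" "j < dim_col (P * D)"
    then have ij: "i < n" "j < n" using carr by auto
    have "(A * P) $$ (i, j) = (\<Sum>k = 0..<n. K (xs ! i) (xs ! k) * F (xs ! j) (xs ! k))"
      using ij by (simp add: A_def P_def scalar_prod_def)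
    also have "\<dots> = ev (xs ! j) * F (xs ! j) (xs ! i)"
      unfolding sum_xs[of "\<lambda>y. K (xs ! i) y * F (xs ! j) y"]
      using eigen[of "xs ! i" "xs ! j"] ij by (simp add: n_def)
    also have "\<dots> = (\<Sum>k = 0..<n. F (xs ! k) (xs ! i) * (if k = j then ev (xs ! k) else 0))"
      using ij by (simp add: if_distrib[of "(*) _"] cong: if_cong)
    also have "\<dots> = (P * D) $$ (i, j)"
      using ij by (simp add: P_def D_def scalar_prod_def)
    finally show "(A * P) $$ (i, j) = (P * D) $$ (i, j)" .
  qed (use carr in auto)
  have "det P \<noteq> 0"
  proof
    assume "det P = 0"
    then obtain w where w: "w \<in> carrier_vec n" "w \<noteq> 0\<^sub>v n" "P *\<^sub>v w = 0\<^sub>v n"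
      using det_0_iff_vec_prod_zero[OF carr(2)] by auto
    \<comment> \<open>A kernel vector of \<open>P\<close> is a linear relation between the
      eigenvectors; \<open>c\<close> carries its entries from positions over to elements of
      \<open>xs\<close>.\<close>
    define c where "c x = w $ (the_inv_into {0..<n} ((!) xs) x)" for x
    have c: "c (xs ! i) = w $ i" if "i < n" for i
      using that bij by (simp add: c_def the_inv_into_f_f bij_betw_def)
    have "(\<Sum>i\<in>set xs. c i * F i x) = 0" if "x \<in> set xs" for x
    proof -
      obtain k where k: "k < n" "x = xs ! k"
        using \<open>x \<in> set xs\<close> by (auto simp: in_set_conv_nth n_def)
      have "(\<Sum>i\<in>set xs. c i * F i x) = (\<Sum>i = 0..<n. F (xs ! i) (xs ! k) * w $ i)"
        by (subst sum_xs[symmetric]) (auto simp: c k intro!: sum.cong)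
      also have "\<dots> = (P *\<^sub>v w) $ k"
        using k w(1) by (auto simp: P_def scalar_prod_def intro!: sum.cong)
      finally show ?thesis using k w(3) by simp
    qed
    then have "c x = 0" if "x \<in> set xs" for x using indep that by blast
    then have "w = 0\<^sub>v n" using w(1) by (intro eq_vecI) (auto simp: c[symmetric] n_def)
    with w(2) show False by simp
  qed
  then obtain Q where Q: "Q \<in> carrier_mat n n" "Q * P = 1\<^sub>m n" "P * Q = 1\<^sub>m n"
    using det_non_zero_imp_unit[OF carr(2), of "()"] by (auto simp: Units_def ring_mat_def)
  have "A = A * (P * Q)" using carr Q by simp
  also have "\<dots> = P * D * Q"
    using carr Q(1) by (simp add: AP flip: assoc_mult_mat[of A n n P n Q n])
  finally have "char_poly A = char_poly D"
    using carr Q by (intro char_poly_similar similar_matI[of A D P Q n]) auto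
  also have "\<dots> = (\<Prod>a\<leftarrow>diag_mat D. [:- a, 1:])"
    by (intro char_poly_upper_triangular[OF carr(3)]) (auto simp: D_def)
  also have "diag_mat D = map ev xs"
    by (auto simp: D_def diag_mat_def n_def intro: nth_equalityI)
  also have "(\<Prod>a\<leftarrow>map ev xs. [:- a, 1:]) = (\<Prod>j\<in>set xs. [:- ev j, 1:])"
    using xs by (simp add: prod.distinct_set_conv_list o_def)
  finally show ?thesis by (simp add: A_def n_def)
qed

section \<open>Arcs and degrees\<close>

lemma (in nomulti_digraph) out_degree_eq_card_neighbours:
  "out_degree G u = card {w. (u, w) \<in> arcs_ends G}"
proof -
  have "inj_on (head G) (out_arcs G u)"
    using no_multi_arcs by (auto simp: inj_on_def arc_to_ends_def)
  moreover have "{w. (u, w) \<in> arcs_ends G} = head G ` out_arcs G u"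
    by (auto simp: arcs_ends_conv)
  ultimately show ?thesis
    by (simp add: out_degree_def card_image)
qed

text \<open>Arcs are pairs of distinct vertices and their ends are the two projections. This gives
  finiteness of the arc set and excludes loops and parallel arcs.\<close>

lemma digraph_degree_graph:
  assumes "finite (verts (degree_graph G))"
  shows "digraph (degree_graph G)"
proof -
  have "arcs (degree_graph G) \<subseteq> verts (degree_graph G) \<times> verts (degree_graph G)"
    by (auto simp: degree_graph_def)
  then have "finite (arcs (degree_graph G))"
    using assms by (meson finite_SigmaI finite_subset)
  then show ?thesis
    using assms by unfold_locales (simp_all, auto simp: degree_graph_def arc_to_ends_def)
qed

text \<open>An induced subgraph keeps every arc with both ends in \<open>S\<close>, so completeness
  can be read off in \<open>\<Gamma>\<close> itself.\<close>

lemma complete_digraph_arcs_ends_induce: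
  assumes "complete_digraph k (induce_subgraph \<Gamma> S)" "x \<in> S" "y \<in> S"
  shows "(x, y) \<in> arcs_ends \<Gamma> \<longleftrightarrow> x \<noteq> y"
proof -
  have "(x, y) \<in> arcs_ends \<Gamma> \<longleftrightarrow> (x, y) \<in> arcs_ends (induce_subgraph \<Gamma> S)"
    using assms(2,3) by (force simp: arcs_ends_conv)
  then show ?thesis using assms by (simp add: complete_digraph_def)
qed

section \<open>The Laplacian indexed by vertices\<close>

text \<open>The Laplacian freed from the enumeration of the vertices, with complex entries because
  the spectrum is taken over the complex numbers.\<close>

definition laplacian_entry :: "('a, 'b) pre_digraph \<Rightarrow> 'a \<Rightarrow> 'a \<Rightarrow> complex" where
  "laplacian_entry \<Gamma> x y =
     (if x = y then of_nat (out_degree \<Gamma> x) else 0) - (if (x, y) \<in> arcs_ends \<Gamma> then 1 else 0)"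

text \<open>Since \<open>vertex_list\<close> is distinct, equal positions and equal vertices
  coincide. For an infinite vertex set both sides are the empty matrix: \<open>card\<close> is 0 and
  the sorted list is empty.\<close>

lemma map_mat_laplacian_mat:
  "map_mat complex_of_real (laplacian_mat \<Gamma>) =
     mat (length (vertex_list \<Gamma>)) (length (vertex_list \<Gamma>))
       (\<lambda>(i, j). laplacian_entry \<Gamma> (vertex_list \<Gamma> ! i) (vertex_list \<Gamma> ! j))"
  by (rule eq_matI)
    (auto simp: laplacian_mat_def degree_mat_def adjacency_mat_def laplacian_entry_def
        vertex_list_def nth_eq_iff_index_eq)

text \<open>The characteristic polynomial splits into one linear factor per vertex, and each factor
  contributes its single root.\<close>

lemma laplacian_spectrum_eigenbasis:
  assumes "finite (verts \<Gamma>)"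
    and "\<And>x j. \<lbrakk>x \<in> verts \<Gamma>; j \<in> verts \<Gamma>\<rbrakk> \<Longrightarrow>
           (\<Sum>y\<in>verts \<Gamma>. laplacian_entry \<Gamma> x y * F j y) = ev j * F j x"
    and "\<forall>c. (\<forall>x\<in>verts \<Gamma>. (\<Sum>i\<in>verts \<Gamma>. c i * F i x) = 0) \<longrightarrow> (\<forall>i\<in>verts \<Gamma>. c i = 0)"
  shows "laplacian_spectrum \<Gamma> = image_mset ev (mset_set (verts \<Gamma>))"
proof -
  have V: "set (vertex_list \<Gamma>) = verts \<Gamma>" "distinct (vertex_list \<Gamma>)"
    using assms(1) by (auto simp: vertex_list_def)
  have "laplacian_spectrum \<Gamma> = proots (\<Prod>j\<in>verts \<Gamma>. [:- ev j, 1:])"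
    unfolding laplacian_spectrum_def map_mat_laplacian_mat
    by (subst char_poly_eigenbasis[of "vertex_list \<Gamma>" "laplacian_entry \<Gamma>" F ev,
          OF V(2), unfolded V(1), OF assms(2,3)]) simp_all
  also have "\<dots> = (\<Sum>j\<in>verts \<Gamma>. {#ev j#})"
    by (subst proots_prod) auto
  also have "\<dots> = image_mset ev (mset_set (verts \<Gamma>))"
    by (induct rule: infinite_finite_induct) auto
  finally show ?thesis .
qed

section \<open>Two cliques sharing a vertex\<close>

text \<open>The shape is expressed by its missing edges, which are exactly those between
  \<open>A\<close> and \<open>B\<close>. This form is symmetric in \<open>A\<close> and
  \<open>B\<close> and covers the shared vertex \<open>v\<close> without a separate case.\<close>

locale two_cliques = digraph \<Gamma> for \<Gamma> :: "('a::linorder, 'b) pre_digraph" +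
  fixes A B :: "'a set" and v :: 'a
  assumes verts_eq: "verts \<Gamma> = A \<union> B \<union> {v}"
    and disj: "A \<inter> B = {}" "v \<notin> A" "v \<notin> B"
    and edges: "\<And>x y. \<lbrakk>x \<in> verts \<Gamma>; y \<in> verts \<Gamma>\<rbrakk> \<Longrightarrow> (x, y) \<in> arcs_ends \<Gamma> \<longleftrightarrow>
      x \<noteq> y \<and> \<not> (x \<in> A \<and> y \<in> B) \<and> \<not> (x \<in> B \<and> y \<in> A)"
begin

lemma finite_parts: "finite A" "finite B"
  using finite_verts verts_eq by auto

lemma sum_verts: "(\<Sum>y\<in>verts \<Gamma>. f y) = sum f A + sum f B + f v" for f :: "'a \<Rightarrow> complex"
  using disj finite_parts by (simp add: verts_eq sum.union_disjoint)

lemma out_degrees: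
  "x \<in> A \<Longrightarrow> out_degree \<Gamma> x = card A"
  "x \<in> B \<Longrightarrow> out_degree \<Gamma> x = card B"
  "out_degree \<Gamma> v = card A + card B"
proof -
  have nb: "{w. (x, w) \<in> arcs_ends \<Gamma>} =
      {w \<in> verts \<Gamma>. x \<noteq> w \<and> \<not> (x \<in> A \<and> w \<in> B) \<and> \<not> (x \<in> B \<and> w \<in> A)}" if "x \<in> verts \<Gamma>" for x
    unfolding set_eq_iff mem_Collect_eq using edges[OF that] adj_in_verts(2)[of x] by blast
  show "out_degree \<Gamma> x = card A" if "x \<in> A"
  proof -
    have "{w. (x, w) \<in> arcs_ends \<Gamma>} = insert v (A - {x})"
      using that disj by (subst nb) (auto simp: verts_eq)
    then show ?thesis
      using that disj finite_parts card_Suc_Diff1[of A x]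
      by (simp add: out_degree_eq_card_neighbours)
  qed
  show "out_degree \<Gamma> x = card B" if "x \<in> B"
  proof -
    have "{w. (x, w) \<in> arcs_ends \<Gamma>} = insert v (B - {x})"
      using that disj by (subst nb) (auto simp: verts_eq)
    then show ?thesis
      using that disj finite_parts card_Suc_Diff1[of B x]
      by (simp add: out_degree_eq_card_neighbours)
  qed
  have "{w. (v, w) \<in> arcs_ends \<Gamma>} = A \<union> B"
    using disj by (subst nb) (auto simp: verts_eq)
  then show "out_degree \<Gamma> v = card A + card B"
    using disj finite_parts by (simp add: out_degree_eq_card_neighbours card_Un_disjoint)
qed

text \<open>The value at \<open>x\<close> depends on \<open>f\<close> only through
  \<open>f x\<close>, \<open>f v\<close> and the sums of \<open>f\<close> over \<open>A\<close> and
  \<open>B\<close>. Checking an eigenvector thus reduces to knowing these few numbers.\<close>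

lemma laplacian_action:
  fixes f :: "'a \<Rightarrow> complex"
  defines "Lf x \<equiv> \<Sum>y\<in>verts \<Gamma>. laplacian_entry \<Gamma> x y * f y"
  shows "x \<in> A \<Longrightarrow> Lf x = (of_nat (card A) + 1) * f x - sum f A - f v"
    and "x \<in> B \<Longrightarrow> Lf x = (of_nat (card B) + 1) * f x - sum f B - f v"
    and "Lf v = of_nat (card A + card B) * f v - sum f A - sum f B"
proof -
  have in_verts: "A \<subseteq> verts \<Gamma>" "B \<subseteq> verts \<Gamma>" "v \<in> verts \<Gamma>"
    using verts_eq by auto
  have Lf: "Lf x = of_nat (out_degree \<Gamma> x) * f x -
      ((\<Sum>y\<in>A. if (x, y) \<in> arcs_ends \<Gamma> then f y else 0)
       + (\<Sum>y\<in>B. if (x, y) \<in> arcs_ends \<Gamma> then f y else 0)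
       + (if (x, v) \<in> arcs_ends \<Gamma> then f v else 0))" if "x \<in> verts \<Gamma>" for x
  proof -
    have "Lf x = (\<Sum>y\<in>verts \<Gamma>. (if x = y then of_nat (out_degree \<Gamma> x) * f y else 0)
        - (if (x, y) \<in> arcs_ends \<Gamma> then f y else 0))"
      unfolding Lf_def laplacian_entry_def by (intro sum.cong) (auto simp: algebra_simps)
    also have "\<dots> = of_nat (out_degree \<Gamma> x) * f x -
        (\<Sum>y\<in>verts \<Gamma>. if (x, y) \<in> arcs_ends \<Gamma> then f y else 0)"
      using that by (simp add: sum_subtractf)
    finally show ?thesis by (simp add: sum_verts)
  qed
  \<comment> \<open>A vertex is adjacent to all of its own part except itself. Completing the sum
    over the part returns one \<open>f x\<close>, which raises the coefficient from the degree to
    the degree plus 1.\<close>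
  have rest: "(\<Sum>y\<in>S. if (x, y) \<in> arcs_ends \<Gamma> then f y else 0) = sum f S - f x"
    if "x \<in> S" "S = A \<or> S = B" for x S
  proof -
    have "(\<Sum>y\<in>S. if (x, y) \<in> arcs_ends \<Gamma> then f y else 0) = (\<Sum>y\<in>S. f y - (if x = y then f y else 0))"
      using that edges disj verts_eq by (intro sum.cong) auto
    then show ?thesis using that finite_parts by (auto simp: sum_subtractf)
  qed
  have none: "(\<Sum>y\<in>S. if (x, y) \<in> arcs_ends \<Gamma> then f y else 0) = 0"
    if "x \<in> A \<and> S = B \<or> x \<in> B \<and> S = A" for x S
    using that edges disj verts_eq by (intro sum.neutral) auto
  have all: "(\<Sum>y\<in>S. if (v, y) \<in> arcs_ends \<Gamma> then f y else 0) = sum f S"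
    if "S = A \<or> S = B" for S
    using that edges disj verts_eq by (intro sum.cong) auto
  show "Lf x = (of_nat (card A) + 1) * f x - sum f A - f v" if x: "x \<in> A"
  proof -
    have "x \<in> verts \<Gamma>" "(x, v) \<in> arcs_ends \<Gamma>"
      using x disj in_verts by (auto simp: edges subset_iff)
    then show ?thesis
      using x by (simp add: Lf rest[of x A] none[of x B] out_degrees algebra_simps)
  qed
  show "Lf x = (of_nat (card B) + 1) * f x - sum f B - f v" if x: "x \<in> B"
  proof -
    have "x \<in> verts \<Gamma>" "(x, v) \<in> arcs_ends \<Gamma>"
      using x disj in_verts by (auto simp: edges subset_iff)
    then show ?thesis
      using x by (simp add: Lf rest[of x B] none[of x A] out_degrees algebra_simps)
  qed
  have "(v, v) \<notin> arcs_ends \<Gamma>" using in_verts by (simp add: edges)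
  then show "Lf v = of_nat (card A + card B) * f v - sum f A - sum f B"
    using in_verts by (simp add: Lf all[of A] all[of B] out_degrees algebra_simps)
qed

text \<open>A difference of unit vectors inside \<open>A\<close> has sum 0 over \<open>A\<close> and
  vanishes on \<open>B\<close> and at \<open>v\<close>, so the Laplacian merely scales it by
  \<open>card A + 1\<close>; likewise for \<open>B\<close>. With the three remaining eigenvectors
  there are as many as vertices.\<close>

lemma laplacian_spectrum_two_cliques:
  assumes ne: "A \<noteq> {}" "B \<noteq> {}"
  shows "laplacian_spectrum \<Gamma> =
    {#0, 1, of_nat (card A + card B + 1)#} + replicate_mset (card B - 1) (of_nat (card B + 1))
      + replicate_mset (card A - 1) (of_nat (card A + 1))"
proof -
  define a b :: complex where "a = of_nat (card A)" and "b = of_nat (card B)"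
  obtain a0 b0 where a0: "a0 \<in> A" and b0: "b0 \<in> B" using ne by auto
  have neq: "a0 \<noteq> v" "b0 \<noteq> v" "a0 \<noteq> b0" using a0 b0 disj by auto
  \<comment> \<open>The eigenvectors are indexed by the vertices themselves: \<open>v\<close>, \<open>a0\<close>, \<open>b0\<close> label the first three.\<close>
  define F where "F j y =
     (if j = v then 1
      else if j = a0 then (if y \<in> A then b else if y \<in> B then - a else 0)
      else if j = b0 then (if y = v then a + b else - 1)
      else if j \<in> A then of_bool (y = j) - of_bool (y = a0)
      else of_bool (y = j) - of_bool (y = b0))" for j y
  define ev where "ev j =
     (if j = v then 0 else if j = a0 then 1 else if j = b0 then a + b + 1
      else if j \<in> A then a + 1 else b + 1)" for j
  have Fv: "F v y = 1" for y
    by (simp add: F_def)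
  have Fa0: "F a0 y = (if y \<in> A then b else if y \<in> B then - a else 0)" for y
    using neq by (simp add: F_def)
  have Fb0: "F b0 y = (if y = v then a + b else - 1)" for y
    using neq by (simp add: F_def)
  have FA: "F j y = of_bool (y = j) - of_bool (y = a0)" if "j \<in> A - {a0}" for j y
    using that neq a0 b0 disj by (auto simp: F_def)
  have FB: "F j y = of_bool (y = j) - of_bool (y = b0)" if "j \<in> B - {b0}" for j y
    using that neq a0 b0 disj by (auto simp: F_def)
  have Fat_v: "F v v = 1" "F a0 v = 0" "F b0 v = a + b" "j \<in> A - {a0} \<Longrightarrow> F j v = 0"
    "j \<in> B - {b0} \<Longrightarrow> F j v = 0" for j
    using neq disj by (auto simp: Fv Fa0 Fb0 FA FB)
  \<comment> \<open>Together with the values at \<open>v\<close>, these sums are what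
    \<open>laplacian_action\<close> asks of each eigenvector besides its value at
    \<open>x\<close>.\<close>
  have sum_F:
    "sum (F v) A = a" "sum (F v) B = b"
    "sum (F a0) A = a * b" "sum (F a0) B = - a * b"
    "sum (F b0) A = - a" "sum (F b0) B = - b"
    "j \<in> A - {a0} \<Longrightarrow> sum (F j) A = 0" "j \<in> A - {a0} \<Longrightarrow> sum (F j) B = 0"
    "j \<in> B - {b0} \<Longrightarrow> sum (F j) A = 0" "j \<in> B - {b0} \<Longrightarrow> sum (F j) B = 0" for j
  proof -
    show "sum (F v) A = a" "sum (F v) B = b" by (simp_all add: Fv a_def b_def)
    show "sum (F a0) A = a * b" by (simp add: Fa0 a_def)
    have "sum (F a0) B = (\<Sum>y\<in>B. - a)" using disj by (intro sum.cong) (auto simp: Fa0)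
    then show "sum (F a0) B = - a * b" by (simp add: b_def)
    have "sum (F b0) S = (\<Sum>y\<in>S. - 1)" if "v \<notin> S" for S
      using that by (intro sum.cong) (auto simp: Fb0)
    then show "sum (F b0) A = - a" "sum (F b0) B = - b" using disj by (simp_all add: a_def b_def)
    show "sum (F j) A = 0" if "j \<in> A - {a0}"
      using that a0 finite_parts by (simp add: FA sum_subtractf of_bool_def)
    show "sum (F j) B = 0" if "j \<in> A - {a0}"
      using that a0 disj by (intro sum.neutral) (auto simp: FA)
    show "sum (F j) A = 0" if "j \<in> B - {b0}"
      using that b0 disj by (intro sum.neutral) (auto simp: FB)
    show "sum (F j) B = 0" if "j \<in> B - {b0}"
      using that b0 finite_parts by (simp add: FB sum_subtractf of_bool_def)
  qed
  have ev_simps: "ev v = 0" "ev a0 = 1" "ev b0 = a + b + 1"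
    "j \<in> A - {a0} \<Longrightarrow> ev j = a + 1" "j \<in> B - {b0} \<Longrightarrow> ev j = b + 1" for j
    using neq a0 b0 disj by (auto simp: ev_def)
  have cases_V: "j = v \<or> j = a0 \<or> j = b0 \<or> j \<in> A - {a0} \<or> j \<in> B - {b0}" if "j \<in> verts \<Gamma>" for j
    using that verts_eq by auto
  have eigen: "(\<Sum>y\<in>verts \<Gamma>. laplacian_entry \<Gamma> x y * F j y) = ev j * F j x"
    if "x \<in> verts \<Gamma>" "j \<in> verts \<Gamma>" for x j
  proof -
    have "x \<in> A \<or> x \<in> B \<or> x = v" using that verts_eq by auto
    then show ?thesis
    proof (elim disjE)
      assume x: "x \<in> A"
      \<comment> \<open>Labels in \<open>A - {a0}\<close> need no entry here: the sum over
        \<open>A\<close> and the value at \<open>v\<close> vanish, so both sides equal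
        \<open>(a + 1) * F j x\<close> whatever \<open>F j x\<close> is.\<close>
      then have Fx: "F v x = 1" "F a0 x = b" "F b0 x = - 1"
        "i \<in> B - {b0} \<Longrightarrow> F i x = 0" for i
        using disj b0 by (auto simp: Fv Fa0 Fb0 FB)
      have "(a + 1) * F j x - sum (F j) A - F j v = ev j * F j x"
        using cases_V[OF that(2)]
        by (elim disjE) (simp_all add: sum_F ev_simps Fx Fat_v algebra_simps)
      then show ?thesis unfolding laplacian_action(1)[OF x] a_def .
    next
      assume x: "x \<in> B"
      then have Fx: "F v x = 1" "F a0 x = - a" "F b0 x = - 1"
        "i \<in> A - {a0} \<Longrightarrow> F i x = 0" for i
        using disj a0 by (auto simp: Fv Fa0 Fb0 FA)
      have "(b + 1) * F j x - sum (F j) B - F j v = ev j * F j x"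
        using cases_V[OF that(2)]
        by (elim disjE) (simp_all add: sum_F ev_simps Fx Fat_v algebra_simps)
      then show ?thesis unfolding laplacian_action(2)[OF x] b_def .
    next
      assume x: "x = v"
      have "(a + b) * F j v - sum (F j) A - sum (F j) B = ev j * F j v"
        using cases_V[OF that(2)]
        by (elim disjE) (simp_all add: sum_F ev_simps Fat_v algebra_simps)
      then show ?thesis unfolding x laplacian_action(3) a_def b_def of_nat_add .
    qed
  qed
  have indep: "c j = 0"
    if comb: "\<And>x. x \<in> verts \<Gamma> \<Longrightarrow> (\<Sum>i\<in>verts \<Gamma>. c i * F i x) = 0" and j: "j \<in> verts \<Gamma>"
    for c j
  proof -
    \<comment> \<open>The relation is separated into the three special eigenvectors and the two
      families of differences.\<close>
    have split: "c v * F v x + c a0 * F a0 x + c b0 * F b0 x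
        + (\<Sum>i\<in>A - {a0}. c i * F i x) + (\<Sum>i\<in>B - {b0}. c i * F i x) = 0" if "x \<in> verts \<Gamma>" for x
      using comb[OF that] a0 b0 finite_parts
      by (simp add: sum_verts sum.remove[of A a0] sum.remove[of B b0] algebra_simps)
    have supp: "(\<Sum>i\<in>S. c i * F i x) = 0" if "\<And>i. i \<in> S \<Longrightarrow> F i x = 0" for S x
      using that by (intro sum.neutral) auto
    have single: "(\<Sum>i\<in>S. c i * F i x) = c x"
      if "x \<in> S" "finite S" "\<And>i. i \<in> S \<Longrightarrow> F i x = of_bool (x = i)" for S x
    proof -
      have "(\<Sum>i\<in>S. c i * F i x) = (\<Sum>i\<in>S. if x = i then c i else 0)"
        using that by (intro sum.cong) auto
      then show ?thesis using that by simp
    qed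
    \<comment> \<open>At \<open>v\<close> all differences and the vector labelled \<open>a0\<close>
      vanish.\<close>
    have at_v: "c v + (a + b) * c b0 = 0"
      using split[of v] verts_eq by (simp add: Fat_v algebra_simps)
    \<comment> \<open>\<open>p\<close> and \<open>q\<close> are the joint contributions of the three
      special eigenvectors at the points of \<open>A\<close> and of \<open>B\<close>; each is
      constant on its part.\<close>
    define p where "p = c v + b * c a0 - c b0"
    define q where "q = c v - a * c a0 - c b0"
    \<comment> \<open>Away from \<open>a0\<close>, the only difference that is nonzero at
      \<open>x\<close> is the one labelled \<open>x\<close>, so its coefficient must cancel
      \<open>p\<close>.\<close>
    have cA: "c x = - p" if "x \<in> A - {a0}" for x
    proof -
      have "(\<Sum>i\<in>A - {a0}. c i * F i x) = c x"
        using that finite_parts by (intro single) (auto simp: FA)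
      moreover have "(\<Sum>i\<in>B - {b0}. c i * F i x) = 0"
        using that b0 disj by (intro supp) (auto simp: FB)
      moreover have "x \<noteq> v" "x \<in> verts \<Gamma>" using that disj verts_eq by auto
      ultimately show ?thesis using split[of x] that
        by (simp add: Fv Fa0 Fb0 p_def algebra_simps eq_neg_iff_add_eq_0)
    qed
    have cB: "c x = - q" if "x \<in> B - {b0}" for x
    proof -
      have "(\<Sum>i\<in>B - {b0}. c i * F i x) = c x"
        using that finite_parts by (intro single) (auto simp: FB)
      moreover have "(\<Sum>i\<in>A - {a0}. c i * F i x) = 0"
        using that a0 disj by (intro supp) (auto simp: FA)
      moreover have "x \<noteq> v" "x \<in> verts \<Gamma>" "x \<notin> A" using that disj verts_eq by auto
      ultimately show ?thesis using split[of x] that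
        by (simp add: Fv Fa0 Fb0 q_def algebra_simps eq_neg_iff_add_eq_0)
    qed
    \<comment> \<open>At \<open>a0\<close> each of the \<open>a - 1\<close> differences takes the
      value -1 and has coefficient \<open>- p\<close>, so it adds another \<open>p\<close>. The
      relation becomes \<open>a * p = 0\<close>, where \<open>a\<close> is nonzero because
      \<open>A\<close> is nonempty.\<close>
    have "p = 0"
    proof -
      have "(\<Sum>i\<in>A - {a0}. c i * F i a0) = (\<Sum>i\<in>A - {a0}. p)"
        by (intro sum.cong) (auto simp: FA cA)
      also have "\<dots> = (a - 1) * p"
        using a0 finite_parts ne by (simp add: a_def of_nat_diff Suc_leI card_gt_0_iff)
      finally have same: "(\<Sum>i\<in>A - {a0}. c i * F i a0) = (a - 1) * p" .
      have other: "(\<Sum>i\<in>B - {b0}. c i * F i a0) = 0"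
        using a0 disj neq by (intro supp) (auto simp: FB)
      have "a0 \<in> verts \<Gamma>" using a0 verts_eq by auto
      then have "p + (a - 1) * p = 0"
        using split[of a0, unfolded same other] a0 neq
        by (simp add: Fv Fa0 Fb0 p_def algebra_simps)
      then have "a * p = 0" by (simp add: algebra_simps)
      then show ?thesis using ne finite_parts by (simp add: a_def)
    qed
    have "q = 0"
    proof -
      have "(\<Sum>i\<in>B - {b0}. c i * F i b0) = (\<Sum>i\<in>B - {b0}. q)"
        by (intro sum.cong) (auto simp: FB cB)
      also have "\<dots> = (b - 1) * q"
        using b0 finite_parts ne by (simp add: b_def of_nat_diff Suc_leI card_gt_0_iff)
      finally have same: "(\<Sum>i\<in>B - {b0}. c i * F i b0) = (b - 1) * q" .
      have other: "(\<Sum>i\<in>A - {a0}. c i * F i b0) = 0"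
        using b0 disj neq by (intro supp) (auto simp: FA)
      have "b0 \<in> verts \<Gamma>" "b0 \<notin> A" using b0 disj verts_eq by auto
      then have "q + (b - 1) * q = 0"
        using split[of b0, unfolded same other] b0 neq
        by (simp add: Fv Fa0 Fb0 q_def algebra_simps)
      then have "b * q = 0" by (simp add: algebra_simps)
      then show ?thesis using ne finite_parts by (simp add: b_def)
    qed
    have pos: "a + b \<noteq> 0" "a + b + 1 \<noteq> 0"
  proof -
    have "card A + card B \<noteq> 0" using ne finite_parts by simp
    then have "(of_nat (card A + card B) :: complex) \<noteq> 0" by (simp only: of_nat_eq_0_iff not_False_eq_True)
    then show "a + b \<noteq> 0" by (simp add: a_def b_def)
    have "of_nat (Suc (card A + card B)) \<noteq> (0::complex)" by (rule of_nat_neq_0)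
    then show "a + b + 1 \<noteq> 0" by (simp add: a_def b_def add_ac)
  qed
    \<comment> \<open>The terms in \<open>c v\<close> and \<open>c b0\<close> cancel in
      \<open>p - q\<close>, which isolates \<open>c a0\<close>. Then \<open>p = 0\<close> identifies
      \<open>c v\<close> with \<open>c b0\<close>, and the relation at \<open>v\<close> forces both
      to be 0.\<close>
    have "(a + b) * c a0 = p - q" by (simp add: p_def q_def algebra_simps)
    then have c_a0: "c a0 = 0" using pos \<open>p = 0\<close> \<open>q = 0\<close> by simp
    then have "c v = c b0" using \<open>p = 0\<close> by (simp add: p_def)
    with at_v have "(a + b + 1) * c b0 = 0" by (simp add: algebra_simps)
    then have "c b0 = 0" using pos by simp
    then show "c j = 0"
      using cases_V[OF j] c_a0 \<open>c v = c b0\<close> cA cB \<open>p = 0\<close> \<open>q = 0\<close> by auto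
  qed
  \<comment> \<open>The vertices are grouped so that \<open>ev\<close> is constant on each of the
    two large blocks.\<close>
  have V: "verts \<Gamma> = insert v (insert a0 (insert b0 ((A - {a0}) \<union> (B - {b0}))))"
    using verts_eq a0 b0 by auto
  have mset_V: "mset_set (insert v (insert a0 (insert b0 ((A - {a0}) \<union> (B - {b0}))))) =
      {#v, a0, b0#} + (mset_set (A - {a0}) + mset_set (B - {b0}))"
  proof -
    have "a0 \<notin> B" "b0 \<notin> A" "(A - {a0}) \<inter> (B - {b0}) = {}" using a0 b0 disj by auto
    then show ?thesis
      using finite_parts neq disj by (simp flip: mset_set_Union)
  qed
  have ev_A: "image_mset ev (mset_set (A - {a0})) = replicate_mset (card A - 1) (a + 1)"
  proof -
    have "image_mset ev (mset_set (A - {a0})) = image_mset (\<lambda>_. a + 1) (mset_set (A - {a0}))"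
      by (intro image_mset_cong) (use finite_parts in \<open>auto simp: ev_simps\<close>)
    then show ?thesis using a0 finite_parts by (simp add: image_mset_const_eq)
  qed
  have ev_B: "image_mset ev (mset_set (B - {b0})) = replicate_mset (card B - 1) (b + 1)"
  proof -
    have "image_mset ev (mset_set (B - {b0})) = image_mset (\<lambda>_. b + 1) (mset_set (B - {b0}))"
      by (intro image_mset_cong) (use finite_parts in \<open>auto simp: ev_simps\<close>)
    then show ?thesis using b0 finite_parts by (simp add: image_mset_const_eq)
  qed
  have "image_mset ev (mset_set (verts \<Gamma>)) = {#0, 1, a + b + 1#}
      + (replicate_mset (card A - 1) (a + 1) + replicate_mset (card B - 1) (b + 1))"
    unfolding V mset_V by (simp add: ev_A ev_B ev_simps(1-3))
  moreover have "laplacian_spectrum \<Gamma> = image_mset ev (mset_set (verts \<Gamma>))"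
  proof (rule laplacian_spectrum_eigenbasis[where F = F and ev = ev])
    show "\<forall>c. (\<forall>x\<in>verts \<Gamma>. (\<Sum>i\<in>verts \<Gamma>. c i * F i x) = 0) \<longrightarrow> (\<forall>i\<in>verts \<Gamma>. c i = 0)"
    proof (intro allI impI ballI)
      fix c i assume "\<forall>x\<in>verts \<Gamma>. (\<Sum>i\<in>verts \<Gamma>. c i * F i x) = 0" "i \<in> verts \<Gamma>"
      then show "c i = 0" using indep[of c i] by blast
    qed
  qed (fact finite_verts, fact eigen)
  ultimately show ?thesis
    by (simp add: a_def b_def add_ac)
qed

end

section \<open>The spectrum of the degree graph\<close>

theorem corollary3p12:
  fixes G :: "('a, 'b) monoid_scheme" and n n1 :: nat
  assumes "n \<ge> 3"
    and "group G" and "finite (carrier G)" and "solvable G"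
    and "card (verts (degree_graph G)) = n"
    and "diameter (degree_graph G) = 2"
    and "\<not> is_block (degree_graph G)"
    and "1 \<le> n1" and "n1 \<le> n - (n1 + 1)"
    and "two_cliques_at_vertex (n - (n1 + 1)) n1 (degree_graph G)"
  shows "laplacian_spectrum (degree_graph G) =
    spectrum_array
      [(0, 1), (1, 1), (of_nat n, 1), (of_nat (n1 + 1), n1 - 1), (of_nat (n - n1), n - (n1 + 2))]"
proof -
  let ?\<Gamma> = "degree_graph G"
  obtain A B v where V: "verts ?\<Gamma> = A \<union> B \<union> {v}" "A \<inter> B = {}" "v \<notin> A" "v \<notin> B"
    and card: "card A = n - (n1 + 1)" "card B = n1"
    and cliques: "complete_digraph (n - (n1 + 1) + 1) (induce_subgraph ?\<Gamma> (A \<union> {v}))"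
      "complete_digraph (n1 + 1) (induce_subgraph ?\<Gamma> (B \<union> {v}))"
    and apart: "\<forall>x \<in> A. \<forall>y \<in> B. (x, y) \<notin> arcs_ends ?\<Gamma> \<and> (y, x) \<notin> arcs_ends ?\<Gamma>"
    using assms(10) unfolding two_cliques_at_vertex_def by blast
  \<comment> \<open>An infinite vertex set would have \<open>card\<close> equal to 0, contrary to
    \<open>n \<ge> 3\<close>.\<close>
  have "finite (verts ?\<Gamma>)"
    using assms(1,5) by (metis card.infinite not_numeral_le_zero)
  then interpret digraph ?\<Gamma> by (rule digraph_degree_graph)
  interpret two_cliques ?\<Gamma> A B v
  proof
    fix x y assume "x \<in> verts ?\<Gamma>" "y \<in> verts ?\<Gamma>"
    \<comment> \<open>Two vertices lie in a common clique or on opposite sides. The first two cases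
      overlap in the pair \<open>v\<close>, \<open>v\<close>, which is harmless.\<close>
    then consider "x \<in> A \<union> {v}" "y \<in> A \<union> {v}" | "x \<in> B \<union> {v}" "y \<in> B \<union> {v}"
      | "x \<in> A \<and> y \<in> B \<or> x \<in> B \<and> y \<in> A" using V by auto
    then show "(x, y) \<in> arcs_ends ?\<Gamma> \<longleftrightarrow>
        x \<noteq> y \<and> \<not> (x \<in> A \<and> y \<in> B) \<and> \<not> (x \<in> B \<and> y \<in> A)"
    proof cases
      case 1
      then show ?thesis using complete_digraph_arcs_ends_induce[OF cliques(1)] V by auto
    next
      case 2
      then show ?thesis using complete_digraph_arcs_ends_induce[OF cliques(2)] V by auto
    next
      case 3
      then show ?thesis using apart by auto
    qed
  qed (use V in auto)
  have "A \<noteq> {}" "B \<noteq> {}" using card assms(8,9) by auto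
  \<comment> \<open>The bounds on \<open>n1\<close> give \<open>n \<ge> n1 + 2\<close>, so none of
    these subtractions of naturals is truncated.\<close>
  moreover have "card A + card B + 1 = n" "card A + 1 = n - n1" "card A - 1 = n - (n1 + 2)"
    using card assms(8,9) by auto
  ultimately show ?thesis
    using laplacian_spectrum_two_cliques by (simp add: spectrum_array_def card(2))
qed

end
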